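(* Let $\{x_i\}_{i=1}^\infty$ be an arbitrary strictly increasing infinite sequence of positive integers and $S_n=\{x_1,\dots,x_n\}$. Let $c\ge1$, $d\ge0$ and $q\ge1$ be integers. Let $f_1,\dots,f_c\in\mathcal{C}$ be distinct and let $(l_1,\dots,l_c)$ be positive integers with $l_1+\dots+l_c>d$. Let $\lambda_n^{(1)}\le\dots\le\lambda_n^{(n)}$ be the eigenvalues of the $n\times n$ matrix $\big((f_1^{(l_1)}*\dots*f_c^{(l_c)}*\mu^{(d)})(\gcd(x_i,x_j))\big)_{1\le i,j\le n}$. Then the sequence $\{\lambda_n^{(q)}\}_{n=q}^\infty$ converges and $\lim_{n\to\infty}\lambda_n^{(q)}\ge0$.
   Context: An arithmetical function is a complex-valued function on the positive integers; $*$ denotes Dirichlet convolution $(f*g)(m)=\sum_{e\mid m}f(e)g(m/e)$, and $\mu$ is the Möbius function. For an arithmetical function $f$, $f^{(0)}=\delta$ (where $\delta(1)=1$, $\delta(m)=0$ for $m>1$) and $f^{(c)}=f^{(c-1)}*f$ for $c\ge1$. For the given sequence $\{x_i\}$, $\mathcal{C}$ is the class of arithmetical functions $f$ such that $(f*\mu)(d')\ge0$ (in particular is real) whenever $d'\mid x_i$ for some $i\ge1$. *)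

theory Defs
  imports
    Complex_Main
    "HOL-Computational_Algebra.Squarefree"
    "Jordan_Normal_Form.Char_Poly"
begin

text \<open>
  An arithmetical function is represented by a function of type \<open>nat \<Rightarrow> complex\<close> whose value
  at \<open>0\<close> is irrelevant: for \<open>m > 0\<close>, none of the operations below reads an argument at \<open>0\<close>
  when evaluated at \<open>m\<close>.
\<close>

definition dirichlet_conv :: "(nat \<Rightarrow> complex) \<Rightarrow> (nat \<Rightarrow> complex) \<Rightarrow> nat \<Rightarrow> complex"
    (infixl \<open>\<circledast>\<close> 70) where
  "(f \<circledast> g) m = (\<Sum>e | e dvd m. f e * g (m div e))"

definition dirichlet_unit :: "nat \<Rightarrow> complex" where
  "dirichlet_unit m = (if m = 1 then 1 else 0)"

definition moebius_mu :: "nat \<Rightarrow> complex" where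
  "moebius_mu m = (if squarefree m then (- 1) ^ card (prime_factors m) else 0)"

primrec dirichlet_power :: "(nat \<Rightarrow> complex) \<Rightarrow> nat \<Rightarrow> nat \<Rightarrow> complex" where
  "dirichlet_power f 0 = dirichlet_unit"
| "dirichlet_power f (Suc k) = dirichlet_power f k \<circledast> f"

text \<open>\<open>dirichlet_prod g c\<close> is \<open>g 1 \<circledast> \<dots> \<circledast> g c\<close>.\<close>

primrec dirichlet_prod :: "(nat \<Rightarrow> nat \<Rightarrow> complex) \<Rightarrow> nat \<Rightarrow> nat \<Rightarrow> complex" where
  "dirichlet_prod g 0 = dirichlet_unit"
| "dirichlet_prod g (Suc k) = dirichlet_prod g k \<circledast> g (Suc k)"

text \<open>Sequences \<open>x\<close> are indexed from \<open>1\<close>; \<open>x 0\<close> is never used.\<close>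

definition class_C :: "(nat \<Rightarrow> nat) \<Rightarrow> (nat \<Rightarrow> complex) set" where
  "class_C x = {f. \<forall>i\<ge>1. \<forall>d. d dvd x i \<longrightarrow> (f \<circledast> moebius_mu) d \<in> \<real> \<and> 0 \<le> Re ((f \<circledast> moebius_mu) d)}"

text \<open>Matrices of \<open>Jordan_Normal_Form\<close> are indexed from \<open>0\<close>, hence the shift.\<close>

definition gcd_matrix :: "(nat \<Rightarrow> nat) \<Rightarrow> (nat \<Rightarrow> complex) \<Rightarrow> nat \<Rightarrow> complex mat" where
  "gcd_matrix x F n = mat n n (\<lambda>(i, j). F (gcd (x (Suc i)) (x (Suc j))))"

text \<open>
  The eigenvalues of a complex matrix with real spectrum, in increasing order and repeated
  according to algebraic multiplicity. The value is unspecified if some eigenvalue is not real.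
\<close>

definition ordered_eigenvalues :: "complex mat \<Rightarrow> real list" where
  "ordered_eigenvalues A =
     (THE es. sorted es \<and> char_poly A = (\<Prod>e\<leftarrow>es. [:- complex_of_real e, 1:]))"

text \<open>The \<open>k\<close>-th smallest eigenvalue, for \<open>1 \<le> k \<le> dim_row A\<close>.\<close>

definition nth_eigenvalue :: "complex mat \<Rightarrow> nat \<Rightarrow> real" where
  "nth_eigenvalue A k = ordered_eigenvalues A ! (k - 1)"

end

theory Submission
  imports Defs "Jordan_Normal_Form.Schur_Decomposition"
begin

text \<open>
  Call \<open>h\<close> nonnegative to order \<open>k\<close> if \<open>h * \<mu>\<^sup>(\<^sup>j\<^sup>)\<close> is nonnegative on all divisors of the \<open>x\<^sub>i\<close> for every
  \<open>j \<le> k\<close>. Orders add under convolution, and members of the class have order 1 by Moebius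
  inversion, so \<open>F * \<mu>\<close> is nonnegative on these divisors as soon as \<open>d + 1 \<le> l\<^sub>1 + \<dots> + l\<^sub>c\<close>. Expanding
  \<open>F(gcd(x\<^sub>i, x\<^sub>j)) = \<Sum> (F * \<mu>)(e)\<close> over the common divisors \<open>e\<close> exhibits the matrix as a nonnegative
  combination of rank one matrices, so all eigenvalues are nonnegative. Each matrix is a leading
  principal submatrix of the next, so by Cauchy interlacing the \<open>q\<close>-th smallest eigenvalue
  decreases with \<open>n\<close>; being bounded below by 0, it converges to a nonnegative limit.
\<close>

subsection \<open>Dirichlet convolution and nonnegativity\<close>

text \<open>Every number divides 0, and a sum over an infinite set is 0 by convention.\<close>

lemma dirichlet_conv_0 [simp]: "(f \<circledast> g) 0 = 0"
  by (simp add: dirichlet_conv_def)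

text \<open>Some identities are available only at positive arguments. Convolutions all vanish at 0,
  so such identities become equalities of functions once convolved.\<close>

lemma dirichlet_conv_cong:
  assumes "\<And>m. 0 < m \<Longrightarrow> f m = f' m" "\<And>m. 0 < m \<Longrightarrow> g m = g' m"
  shows "f \<circledast> g = f' \<circledast> g'"
proof
  fix m
  show "(f \<circledast> g) m = (f' \<circledast> g') m"
  proof (cases "m = 0")
    case False
    then show ?thesis
      unfolding dirichlet_conv_def using assms
      by (intro sum.cong) (auto intro!: Nat.gr0I elim!: dvdE)
  qed simp
qed

lemma dirichlet_conv_commute: "f \<circledast> g = g \<circledast> f"
proof
  fix m
  show "(f \<circledast> g) m = (g \<circledast> f) m"
  proof (cases "m = 0")
    case False
    then show ?thesis
      unfolding dirichlet_conv_def
      by (intro sum.reindex_bij_witness[of _ "\<lambda>e. m div e" "\<lambda>e. m div e"])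
         (auto simp: mult.commute elim!: dvdE)
  qed simp
qed

text \<open>Both sides sum \<open>f a * g b * h r\<close> over all factorisations
  \<open>m = a * b * r\<close>; one set of pairs records \<open>(a * b, a)\<close>, the other
  \<open>(a, b)\<close>.\<close>

lemma dirichlet_conv_assoc: "(f \<circledast> g) \<circledast> h = f \<circledast> (g \<circledast> h)"
proof
  fix m
  show "((f \<circledast> g) \<circledast> h) m = (f \<circledast> (g \<circledast> h)) m"
  proof (cases "m = 0")
    case False
    have "((f \<circledast> g) \<circledast> h) m = (\<Sum>e | e dvd m. \<Sum>a | a dvd e. f a * g (e div a) * h (m div e))"
      by (simp add: dirichlet_conv_def sum_distrib_right)
    also have "\<dots> = (\<Sum>(e, a)\<in>(SIGMA e:{e. e dvd m}. {a. a dvd e}). f a * g (e div a) * h (m div e))"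
      using False by (subst sum.Sigma) (auto dest: dvd_pos_nat)
    also have "\<dots> = (\<Sum>(a, b)\<in>(SIGMA a:{a. a dvd m}. {b. b dvd m div a}). f a * (g b * h (m div a div b)))"
      using False
      by (intro sum.reindex_bij_witness[of _ "\<lambda>(a, b). (a * b, a)" "\<lambda>(e, a). (a, e div a)"])
         (auto elim!: dvdE simp: mult_ac)
    also have "\<dots> = (\<Sum>a | a dvd m. \<Sum>b | b dvd m div a. f a * (g b * h (m div a div b)))"
      using False by (subst sum.Sigma) (auto elim!: dvdE)
    also have "\<dots> = (f \<circledast> (g \<circledast> h)) m"
      by (simp add: dirichlet_conv_def sum_distrib_left)
    finally show ?thesis .
  qed simp
qed

lemma dirichlet_conv_unit_right: "0 < m \<Longrightarrow> (f \<circledast> dirichlet_unit) m = f m"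
proof -
  assume m: "0 < m"
  have "(f \<circledast> dirichlet_unit) m = (\<Sum>e | e dvd m. if e = m then f m else 0)"
    unfolding dirichlet_conv_def dirichlet_unit_def using m
    by (intro sum.cong) (auto elim!: dvdE)
  also have "\<dots> = f m" using m by simp
  finally show ?thesis .
qed

lemma dirichlet_conv_unit_left: "0 < m \<Longrightarrow> (dirichlet_unit \<circledast> f) m = f m"
  using dirichlet_conv_unit_right[of m f] by (simp add: dirichlet_conv_commute)

lemma dirichlet_power_add:
  "0 < m \<Longrightarrow> dirichlet_power f (a + b) m = (dirichlet_power f a \<circledast> dirichlet_power f b) m"
proof (induction b arbitrary: m)
  case 0
  then show ?case by (simp add: dirichlet_conv_unit_right)
next
  case (Suc b)
  have "dirichlet_power f (a + b) \<circledast> f = (dirichlet_power f a \<circledast> dirichlet_power f b) \<circledast> f"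
    by (rule dirichlet_conv_cong) (simp_all add: Suc.IH)
  then show ?case by (simp add: dirichlet_conv_assoc)
qed

section \<open>The Moebius function and Moebius inversion\<close>

lemma moebius_mu_mult_prime:
  fixes p e :: nat
  assumes "prime p" "\<not> p dvd e" "squarefree e"
  shows "moebius_mu (p * e) = - moebius_mu e"
proof -
  have e: "e \<noteq> 0" using assms(2) by (metis dvd_0_right)
  have "coprime p e" using assms(1,2) by (simp add: prime_imp_coprime)
  then have "squarefree (p * e)"
    using assms by (simp add: squarefree_mult_coprime squarefree_prime)
  moreover have "prime_factors (p * e) = insert p (prime_factors e)"
    using assms(1) e by (simp add: prime_factors_product prime_prime_factors)
  moreover have "p \<notin> prime_factors e" using assms(2) by (auto simp: in_prime_factors_iff)
  ultimately show ?thesis using assms(3) by (simp add: moebius_mu_def)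
qed

text \<open>For \<open>m > 1\<close> fix a prime \<open>p\<close> dividing \<open>m\<close>. The
  squarefree divisors fall into pairs \<open>e\<close>, \<open>p * e\<close> with \<open>p\<close>
  not dividing \<open>e\<close>, and the two terms of each pair cancel.\<close>

lemma sum_moebius_mu_divisors:
  assumes "0 < m"
  shows "(\<Sum>e | e dvd m. moebius_mu e) = dirichlet_unit m"
proof (cases "m = 1")
  case True
  then show ?thesis by (simp add: moebius_mu_def dirichlet_unit_def)
next
  case False
  then obtain p where p: "prime p" "p dvd m" using prime_factor_nat by blast
  define S where "S = {e. e dvd m \<and> squarefree e \<and> \<not> p dvd e}"
  have fin: "finite S" using assms unfolding S_def by simp
  have split: "{e. e dvd m \<and> squarefree e} = S \<union> (\<lambda>e. p * e) ` S"
  proof (intro equalityI subsetI)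
    fix e assume "e \<in> {e. e dvd m \<and> squarefree e}"
    then have e: "e dvd m" "squarefree e" by auto
    show "e \<in> S \<union> (\<lambda>e. p * e) ` S"
    proof (cases "p dvd e")
      case True
      then obtain a where a: "e = p * a" by blast
      have "\<not> p dvd a"
      proof
        assume "p dvd a"
        then have "p\<^sup>2 dvd e" by (simp add: a power2_eq_square)
        then show False using squarefreeD[OF e(2)] p(1) not_prime_unit by blast
      qed
      then have "a \<in> S"
        using e dvd_mult_right[of p a m] unfolding S_def a by (auto dest: squarefree_multD)
      then show ?thesis using a by blast
    qed (use e in \<open>auto simp: S_def\<close>)
  next
    fix e assume "e \<in> S \<union> (\<lambda>e. p * e) ` S"
    moreover have "p * a dvd m \<and> squarefree (p * a)" if "a \<in> S" for a
    proof -
      have "coprime p a" using that p(1) by (auto simp: S_def intro: prime_imp_coprime)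
      then show ?thesis
        using that p by (auto simp: S_def intro: divides_mult squarefree_mult_coprime squarefree_prime)
    qed
    ultimately show "e \<in> {e. e dvd m \<and> squarefree e}" by (auto simp: S_def)
  qed
  have "(\<Sum>e | e dvd m. moebius_mu e) = (\<Sum>e | e dvd m \<and> squarefree e. moebius_mu e)"
    using assms by (intro sum.mono_neutral_right) (auto simp: moebius_mu_def)
  also have "\<dots> = (\<Sum>e\<in>S. moebius_mu e) + (\<Sum>e\<in>(\<lambda>e. p * e) ` S. moebius_mu e)"
    unfolding split using fin by (intro sum.union_disjoint) (auto simp: S_def)
  also have "(\<Sum>e\<in>(\<lambda>e. p * e) ` S. moebius_mu e) = (\<Sum>e\<in>S. moebius_mu (p * e))"
    using p(1) by (subst sum.reindex) (auto simp: inj_on_def)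
  also have "\<dots> = (\<Sum>e\<in>S. - moebius_mu e)"
    using p(1) by (intro sum.cong) (auto simp: S_def moebius_mu_mult_prime)
  finally show ?thesis using False by (simp add: sum_negf dirichlet_unit_def)
qed

text \<open>\<open>moebius_mu\<close> and the constant function 1 are inverse to each other under
  convolution. This form transfers nonnegativity from \<open>f \<circledast> moebius_mu\<close> to
  \<open>f\<close> and expands the entries of gcd matrices.\<close>

lemma moebius_inversion:
  assumes "0 < m"
  shows "f m = (\<Sum>e | e dvd m. (f \<circledast> moebius_mu) e)"
proof -
  \<comment> \<open>Writing the unit as its own square makes both sides convolutions, so
    \<open>dirichlet_conv_0\<close> settles the argument 0.\<close>
  have "moebius_mu \<circledast> (\<lambda>_. 1) = dirichlet_unit \<circledast> dirichlet_unit"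
  proof
    fix m
    show "(moebius_mu \<circledast> (\<lambda>_. 1)) m = (dirichlet_unit \<circledast> dirichlet_unit) m"
      by (cases "m = 0")
         (simp_all add: dirichlet_conv_unit_right sum_moebius_mu_divisors dirichlet_conv_def[of moebius_mu])
  qed
  then have "(f \<circledast> moebius_mu) \<circledast> (\<lambda>_. 1) = f \<circledast> (dirichlet_unit \<circledast> dirichlet_unit)"
    by (simp add: dirichlet_conv_assoc)
  then have "((f \<circledast> moebius_mu) \<circledast> (\<lambda>_. 1)) m = f m"
    using assms by (simp add: dirichlet_conv_unit_right flip: dirichlet_conv_assoc)
  then show ?thesis by (simp add: dirichlet_conv_def[of "f \<circledast> moebius_mu"])
qed

section \<open>Nonnegativity on a divisor-closed set\<close>

text \<open>The order on complex numbers makes \<open>0 \<le> z\<close> include that \<open>z\<close> is real.\<close>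

definition nonneg_to_order :: "nat set \<Rightarrow> nat \<Rightarrow> (nat \<Rightarrow> complex) \<Rightarrow> bool" where
  "nonneg_to_order D k h \<longleftrightarrow> (\<forall>j\<le>k. \<forall>m\<in>D. 0 \<le> (h \<circledast> dirichlet_power moebius_mu j) m)"

text \<open>Models the set of all divisors of the \<open>x i\<close>. A convolution at
  \<open>m\<close> reads its factors only at divisors of \<open>m\<close>, so nonnegativity on
  \<open>D\<close> passes to convolutions.\<close>

locale divisor_closed =
  fixes D :: "nat set"
  assumes pos: "m \<in> D \<Longrightarrow> 0 < m"
    and dvd_closed: "m \<in> D \<Longrightarrow> e dvd m \<Longrightarrow> e \<in> D"
begin

lemma dirichlet_conv_nonneg:
  assumes "\<And>m. m \<in> D \<Longrightarrow> 0 \<le> f m" "\<And>m. m \<in> D \<Longrightarrow> 0 \<le> g m" "m \<in> D"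
  shows "0 \<le> (f \<circledast> g) m"
  unfolding dirichlet_conv_def
proof (intro sum_nonneg mult_nonneg_nonneg assms(1,2))
  fix e assume "e \<in> {e. e dvd m}"
  then show "e \<in> D" "m div e \<in> D"
    using assms(3) dvd_closed[of m e] dvd_closed[of m "m div e"] by auto
qed

text \<open>Order 0 is the most to expect in general: one convolution with \<open>moebius_mu\<close>
  yields \<open>moebius_mu\<close>, which is -1 at primes.\<close>

lemma nonneg_to_order_unit: "nonneg_to_order D 0 dirichlet_unit"
  unfolding nonneg_to_order_def
  by (auto simp: dirichlet_conv_unit_right pos dirichlet_unit_def less_eq_complex_def)

text \<open>The \<open>j\<close> Moebius factors are shared out, at most \<open>a\<close> of them to
  \<open>g\<close> and at most \<open>b\<close> to \<open>h\<close>; each share leaves a function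
  nonnegative on \<open>D\<close>.\<close>

lemma nonneg_to_order_conv:
  assumes "nonneg_to_order D a g" "nonneg_to_order D b h"
  shows "nonneg_to_order D (a + b) (g \<circledast> h)"
  unfolding nonneg_to_order_def
proof (intro allI impI ballI)
  fix j m assume j: "j \<le> a + b" and m: "m \<in> D"
  let ?M = "dirichlet_power moebius_mu"
  obtain i k where ik: "i \<le> a" "k \<le> b" "j = i + k"
    using j that[of "min a j" "j - min a j"] by auto
  have "(g \<circledast> h) \<circledast> ?M j = (g \<circledast> h) \<circledast> (?M i \<circledast> ?M k)"
    by (rule dirichlet_conv_cong) (simp_all add: ik(3) dirichlet_power_add)
  also have "\<dots> = (g \<circledast> ?M i) \<circledast> (h \<circledast> ?M k)"
    by (metis dirichlet_conv_assoc dirichlet_conv_commute)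
  finally show "0 \<le> ((g \<circledast> h) \<circledast> ?M j) m"
    using assms ik m unfolding nonneg_to_order_def by (auto intro: dirichlet_conv_nonneg)
qed

lemma nonneg_to_order_power:
  assumes "nonneg_to_order D 1 f"
  shows "nonneg_to_order D k (dirichlet_power f k)"
proof (induction k)
  case (Suc k)
  then show ?case using nonneg_to_order_conv[OF Suc assms] by simp
qed (simp add: nonneg_to_order_unit)

lemma nonneg_to_order_prod:
  assumes "\<And>i. i \<in> {1..c} \<Longrightarrow> nonneg_to_order D (l i) (g i)"
  shows "nonneg_to_order D (\<Sum>i=1..c. l i) (dirichlet_prod g c)"
  using assms
proof (induction c)
  case (Suc c)
  then show ?case using nonneg_to_order_conv[of _ "dirichlet_prod g c" "l (Suc c)" "g (Suc c)"] by simp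
qed (simp add: nonneg_to_order_unit)

text \<open>Order 1 also demands that \<open>f\<close> itself be nonnegative. By Moebius inversion
  \<open>f m\<close> is a sum of values of \<open>f \<circledast> moebius_mu\<close> at divisors of
  \<open>m\<close>, all of which lie in \<open>D\<close>.\<close>

lemma nonneg_to_order_1I:
  assumes "\<And>m. m \<in> D \<Longrightarrow> 0 \<le> (f \<circledast> moebius_mu) m"
  shows "nonneg_to_order D 1 f"
  unfolding nonneg_to_order_def
proof (intro allI impI ballI)
  fix j m assume "j \<le> (1::nat)" and m: "m \<in> D"
  then consider "j = 0" | "j = 1" by linarith
  then show "0 \<le> (f \<circledast> dirichlet_power moebius_mu j) m"
  proof cases
    case 1
    have "f m = (\<Sum>e | e dvd m. (f \<circledast> moebius_mu) e)"
      using m pos by (intro moebius_inversion)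
    also have "\<dots> \<ge> 0" using m by (intro sum_nonneg assms) (auto intro: dvd_closed)
    finally show ?thesis using 1 m pos by (simp add: dirichlet_conv_unit_right)
  next
    case 2
    \<comment> \<open>The first Dirichlet power of \<open>moebius_mu\<close> unfolds to
      \<open>dirichlet_unit \<circledast> moebius_mu\<close>.\<close>
    have "f \<circledast> (dirichlet_unit \<circledast> moebius_mu) = f \<circledast> moebius_mu"
      by (rule dirichlet_conv_cong) (simp_all add: dirichlet_conv_unit_left)
    then show ?thesis using 2 m assms by simp
  qed
qed

end

text \<open>The divisors of the gcd are the common divisors. Summing over a fixed \<open>E\<close>
  gives all matrix entries one index set, so that sums can later be interchanged.\<close>

lemma gcd_moebius_expansion:
  fixes a b :: nat
  assumes "0 < a" "0 < b" "finite E" "{e. e dvd a} \<subseteq> E"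
  shows "F (gcd a b) = (\<Sum>e\<in>E. if e dvd a \<and> e dvd b then (F \<circledast> moebius_mu) e else 0)"
proof -
  have "F (gcd a b) = (\<Sum>e | e dvd gcd a b. (F \<circledast> moebius_mu) e)"
    using assms by (intro moebius_inversion) auto
  also have "\<dots> = (\<Sum>e\<in>E. if e dvd a \<and> e dvd b then (F \<circledast> moebius_mu) e else 0)"
    using assms(3,4) by (intro sum.mono_neutral_cong_left) auto
  finally show ?thesis .
qed

subsection \<open>Spectral decomposition of Hermitian matrices\<close>

lemma mat_adjoint_carrier [simp]:
  "A \<in> carrier_mat n m \<Longrightarrow> mat_adjoint A \<in> carrier_mat m n"
  unfolding mat_adjoint_def carrier_mat_def by auto

lemma mat_adjoint_dim [simp]:
  "dim_row (mat_adjoint A) = dim_col A" "dim_col (mat_adjoint A) = dim_row A"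
  by (simp_all add: mat_adjoint_def)

lemma mat_adjoint_index [simp]:
  "i < dim_col A \<Longrightarrow> j < dim_row A \<Longrightarrow> mat_adjoint A $$ (i, j) = conjugate (A $$ (j, i))"
  by (simp add: mat_adjoint_def mat_of_rows_index)

lemma mat_adjoint_adjoint [simp]: "mat_adjoint (mat_adjoint A) = A"
  by (rule eq_matI) auto

lemma mat_adjoint_mult:
  fixes A B :: "complex mat"
  assumes "A \<in> carrier_mat n m" "B \<in> carrier_mat m k"
  shows "mat_adjoint (A * B) = mat_adjoint B * mat_adjoint A"
  by (rule eq_matI) (use assms in \<open>auto simp: scalar_prod_def mult.commute\<close>)

definition unitary_mat :: "nat \<Rightarrow> complex mat \<Rightarrow> bool" where
  "unitary_mat n U \<longleftrightarrow> U \<in> carrier_mat n n \<and> mat_adjoint U * U = 1\<^sub>m n"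

text \<open>A one-sided inverse of a square matrix is two-sided.\<close>

lemma unitary_matD:
  assumes "unitary_mat n U"
  shows "U \<in> carrier_mat n n" "mat_adjoint U \<in> carrier_mat n n"
    "mat_adjoint U * U = 1\<^sub>m n" "U * mat_adjoint U = 1\<^sub>m n"
  using assms mat_mult_left_right_inverse[of "mat_adjoint U" n U]
  unfolding unitary_mat_def by auto

lemma unitary_mat_mult:
  assumes "unitary_mat n U" "unitary_mat n V"
  shows "unitary_mat n (U * V)"
proof -
  note U = unitary_matD[OF assms(1)] and V = unitary_matD[OF assms(2)]
  have "mat_adjoint (U * V) * (U * V) = mat_adjoint V * (mat_adjoint U * U) * V"
    using U(1,2) V(1,2)
    by (simp add: mat_adjoint_mult[of _ n n _ n] assoc_mult_mat[of _ n n _ n _ n] mult_carrier_mat[of _ n n _ n])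
  also have "\<dots> = 1\<^sub>m n" using U V by simp
  finally show ?thesis using U V by (simp add: unitary_mat_def)
qed

lemma mat_adjoint_four_block:
  fixes A D :: "complex mat"
  assumes "A \<in> carrier_mat n n" "D \<in> carrier_mat m m"
  shows "mat_adjoint (four_block_mat A (0\<^sub>m n m) (0\<^sub>m m n) D)
    = four_block_mat (mat_adjoint A) (0\<^sub>m n m) (0\<^sub>m m n) (mat_adjoint D)"
  by (rule eq_matI) (use assms in auto)

lemma mult_four_block_diag:
  fixes A B C D :: "complex mat"
  assumes "A \<in> carrier_mat n n" "B \<in> carrier_mat n n" "C \<in> carrier_mat m m" "D \<in> carrier_mat m m"
  shows "four_block_mat A (0\<^sub>m n m) (0\<^sub>m m n) C * four_block_mat B (0\<^sub>m n m) (0\<^sub>m m n) D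
    = four_block_mat (A * B) (0\<^sub>m n m) (0\<^sub>m m n) (C * D)"
  by (subst mult_four_block_mat[of _ n n _ m _ m]) (use assms in auto)

lemma mat_adjoint_one [simp]: "mat_adjoint (1\<^sub>m n :: complex mat) = 1\<^sub>m n"
  by (rule eq_matI) auto

lemma unitary_mat_four_block:
  assumes "unitary_mat m P"
  shows "unitary_mat (Suc m) (four_block_mat (1\<^sub>m 1) (0\<^sub>m 1 m) (0\<^sub>m m 1) P)"
proof -
  note P = unitary_matD[OF assms]
  have "four_block_mat (1\<^sub>m 1) (0\<^sub>m 1 m) (0\<^sub>m m 1) (1\<^sub>m m) = (1\<^sub>m (Suc m) :: complex mat)"
    by (rule eq_matI) auto
  then show ?thesis
    using P four_block_carrier_mat[of "1\<^sub>m 1 :: complex mat" 1 1 P m m]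
    by (simp add: unitary_mat_def mat_adjoint_four_block mult_four_block_diag)
qed

section \<open>Unitary diagonalisation with a prescribed order of the eigenvalues\<close>

text \<open>Complete \<open>v\<close> to a basis, orthogonalise and normalise. Gram-Schmidt keeps
  the first vector, so the first column is \<open>v\<close> scaled to norm 1.\<close>

lemma unitary_mat_with_first_col:
  assumes v: "v \<in> carrier_vec n" "v \<noteq> 0\<^sub>v n" and n: "0 < n"
  obtains W k where "unitary_mat n W" "col W 0 = k \<cdot>\<^sub>v v"
proof -
  interpret cof_vec_space n "TYPE(complex)" .
  define b where "b = basis_completion v"
  define ws where "ws = gram_schmidt n b"
  note bc = basis_completion[OF v, folded b_def]
  obtain vs where bv: "b = v # vs" using bc(6,7) n by (cases b) auto
  note gs = gram_schmidt_result[OF bc(2,4,5) refl, folded ws_def]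
  have hd: "hd ws = v" using gram_schmidt_hd[OF v(1), of vs] by (simp add: ws_def bv)
  have len: "length ws = n" using gs(4) bc(6) by simp
  have wsc: "ws ! j \<in> carrier_vec n" if "j < n" for j using gs(3) len that by auto
  \<comment> \<open>The vectors \<open>ws\<close> are only orthogonal; dividing by their norms
    \<open>r j\<close> makes them orthonormal.\<close>
  define r where "r j = complex_of_real (sqrt (Re (ws ! j \<bullet>c ws ! j)))" for j
  have r: "r j * r j = ws ! j \<bullet>c ws ! j" "r j \<noteq> 0" if "j < n" for j
  proof -
    have "ws ! j \<bullet>c ws ! j \<ge> 0" by (rule conjugate_square_ge_0_vec)
    moreover have "ws ! j \<bullet>c ws ! j \<noteq> 0" using corthogonalD[OF gs(2)] that len by blast
    ultimately show "r j * r j = ws ! j \<bullet>c ws ! j" "r j \<noteq> 0"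
      unfolding r_def
      by (auto simp: less_eq_complex_def complex_eq_iff simp flip: of_real_mult)
  qed
  define W where "W = mat n n (\<lambda>(i, j). ws ! j $ i / r j)"
  have W: "W \<in> carrier_mat n n" by (simp add: W_def)
  have "mat_adjoint W * W = 1\<^sub>m n"
  proof (rule eq_matI)
    fix i j assume "i < dim_row (1\<^sub>m n)" "j < dim_col (1\<^sub>m n)"
    then have ij: "i < n" "j < n" by auto
    have "(mat_adjoint W * W) $$ (i, j) = (\<Sum>k<n. cnj (ws ! i $ k / r i) * (ws ! j $ k / r j))"
      using ij by (simp add: W_def scalar_prod_def atLeast0LessThan)
    also have "\<dots> = (\<Sum>k<n. ws ! j $ k * cnj (ws ! i $ k)) / (r i * r j)"
      by (simp add: sum_divide_distrib r_def mult.commute)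
    also have "(\<Sum>k<n. ws ! j $ k * cnj (ws ! i $ k)) = ws ! j \<bullet>c ws ! i"
      using wsc[OF ij(1)] by (simp add: scalar_prod_def atLeast0LessThan)
    also have "(ws ! j \<bullet>c ws ! i) / (r i * r j) = (if i = j then 1 else 0)"
      using corthogonalD[OF gs(2), of j i] ij len r(1)[of i] r(2)[of i] by auto
    finally show "(mat_adjoint W * W) $$ (i, j) = 1\<^sub>m n $$ (i, j)" using ij by simp
  qed (use W in auto)
  moreover have "col W 0 = inverse (r 0) \<cdot>\<^sub>v v"
  proof (rule eq_vecI)
    have "ws ! 0 = v" using hd len n by (cases ws) auto
    then show "col W 0 $ i = (inverse (r 0) \<cdot>\<^sub>v v) $ i" if "i < dim_vec (inverse (r 0) \<cdot>\<^sub>v v)" for i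
      using that v n by (simp add: W_def field_simps)
  qed (use W v in auto)
  ultimately show thesis using W that by (auto simp: unitary_mat_def)
qed

lemma unitary_conjugate_cancel:
  assumes "unitary_mat n W" "A \<in> carrier_mat n n"
  shows "W * (mat_adjoint W * A * W) * mat_adjoint W = A"
proof -
  note W = unitary_matD[OF assms(1)]
  have "W * (mat_adjoint W * A * W) * mat_adjoint W = (W * mat_adjoint W) * A * (W * mat_adjoint W)"
    using W(1,2) assms(2) by (simp add: assoc_mult_mat[of _ n n _ n _ n]
      mult_carrier_mat[of _ n n _ n])
  also have "\<dots> = A" using W(4) assms(2) by simp
  finally show ?thesis .
qed

text \<open>Deflation: conjugating by a unitary matrix whose first column is an eigenvector for the
  head of \<open>es\<close> splits off a 1 by 1 block, and induction treats the rest. The diagonal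
  follows the order of the list, so a sorted list gives sorted eigenvectors.\<close>

lemma hermitian_diagonalization:
  assumes "A \<in> carrier_mat n n" "mat_adjoint A = A" "char_poly A = (\<Prod>e\<leftarrow>es. [:- e, 1:])"
  obtains U where "unitary_mat n U" "A = U * mat_diag n (\<lambda>i. es ! i) * mat_adjoint U"
proof -
  have "\<exists>U. unitary_mat n U \<and> A = U * mat_diag n (\<lambda>i. es ! i) * mat_adjoint U"
    using assms
  proof (induction es arbitrary: n A)
    case Nil
    have "n = 0" using degree_monic_char_poly[OF Nil.prems(1)] Nil.prems(3) by simp
    then have "unitary_mat n (1\<^sub>m 0)" "A = 1\<^sub>m 0 * mat_diag n (\<lambda>i. [] ! i) * mat_adjoint (1\<^sub>m 0)"
      using Nil.prems(1) by (auto simp: unitary_mat_def intro!: eq_matI)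
    then show ?case by blast
  next
    case (Cons e es)
    note A = Cons.prems(1) and herm = Cons.prems(2)
    have cp: "char_poly A = [:- e, 1:] * (\<Prod>e\<leftarrow>es. [:- e, 1:])" using Cons.prems(3) by simp
    have ev: "eigenvalue A e" unfolding eigenvalue_root_char_poly[OF A] cp by simp
    \<comment> \<open>Comparing degrees shows that \<open>n\<close> is positive, so there is a first
      column to split off.\<close>
    have "monic (\<Prod>e\<leftarrow>es. [:- e, 1:])" by (rule monic_prod_list) auto
    then have "degree (char_poly A) = Suc (degree (\<Prod>e\<leftarrow>es. [:- e, 1:]))"
      unfolding cp by (subst degree_mult_eq) auto
    then obtain m where m: "n = Suc m" using degree_monic_char_poly[OF A] by auto
    from ev obtain v where v: "v \<in> carrier_vec n" "v \<noteq> 0\<^sub>v n" "A *\<^sub>v v = e \<cdot>\<^sub>v v"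
      unfolding eigenvalue_def eigenvector_def using A by auto
    obtain W k where W: "unitary_mat n W" and col: "col W 0 = k \<cdot>\<^sub>v v"
      using unitary_mat_with_first_col[OF v(1,2)] m by auto
    note Wc = unitary_matD[OF W]
    define B where "B = mat_adjoint W * A * W"
    have B: "B \<in> carrier_mat n n" unfolding B_def using Wc(1,2) A by (intro mult_carrier_mat[of _ n n _ n])
    have B': "B = mat_adjoint W * (A * W)" using Wc A by (simp add: B_def assoc_mult_mat[of _ n n _ n _ n]
      mult_carrier_mat[of _ n n _ n])
    have hermB: "mat_adjoint B = B"
      using Wc A herm by (simp add: B' mat_adjoint_mult[of _ n n _ n] assoc_mult_mat[of _ n n _ n _ n]
      mult_carrier_mat[of _ n n _ n])
    \<comment> \<open>\<open>A\<close> multiplies the first column of \<open>W\<close> by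
      \<open>e\<close>, and the orthonormality of the columns turns this into \<open>e\<close> times
      the first unit vector.\<close>
    have col0: "B $$ (i, 0) = (if i = 0 then e else 0)" if i: "i < n" for i
    proof -
      have "col (A * W) 0 = A *\<^sub>v col W 0"
        by (rule eq_vecI) (use A Wc m in auto)
      also have "\<dots> = e \<cdot>\<^sub>v col W 0"
        using v A by (simp add: col mult_mat_vec smult_smult_assoc mult.commute)
      finally have "col (A * W) 0 = e \<cdot>\<^sub>v col W 0" .
      then have "B $$ (i, 0) = e * (row (mat_adjoint W) i \<bullet> col W 0)"
        using i m Wc A by (simp add: B')
      also have "row (mat_adjoint W) i \<bullet> col W 0 = (mat_adjoint W * W) $$ (i, 0)"
        using i m Wc(1) by simp
      also have "\<dots> = (if i = 0 then 1 else 0)" unfolding Wc(3) using i m by simp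
      finally show ?thesis by simp
    qed
    have row0: "B $$ (0, i) = 0" if "0 < i" "i < n" for i
    proof -
      have "B $$ (0, i) = mat_adjoint B $$ (0, i)" using hermB by simp
      also have "\<dots> = cnj (B $$ (i, 0))" using B that by simp
      finally show ?thesis using col0[of i] that by simp
    qed
    define C where "C = mat m m (\<lambda>(i, j). B $$ (Suc i, Suc j))"
    define E where "E = mat 1 1 (\<lambda>_. e)"
    have C: "C \<in> carrier_mat m m" and E: "E \<in> carrier_mat 1 1" by (simp_all add: C_def E_def)
    have Bblock: "B = four_block_mat E (0\<^sub>m 1 m) (0\<^sub>m m 1) C"
      by (rule eq_matI) (use B m col0 row0 in \<open>auto simp: C_def E_def less_Suc_eq_0_disj\<close>)
    \<comment> \<open>Similarity gives \<open>B\<close> the characteristic polynomial of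
      \<open>A\<close>; cancelling the factor of the block \<open>E\<close> leaves for
      \<open>C\<close> exactly the tail \<open>es\<close>.\<close>
    have "similar_mat B A"
      unfolding similar_mat_def
      by (intro exI, rule similar_mat_witI[of "mat_adjoint W" W n]) (use Wc A B in \<open>simp_all add: B_def\<close>)
    then have "char_poly B = [:- e, 1:] * (\<Prod>e\<leftarrow>es. [:- e, 1:])"
      using cp by (simp add: char_poly_similar)
    moreover have "char_poly B = char_poly E * char_poly C"
      unfolding Bblock by (rule char_poly_four_block_zeros_col[OF E _ C]) simp
    moreover have "char_poly E = [:- e, 1:]"
      by (simp add: E_def char_poly_defs det_def sign_def)
    ultimately have cpC: "char_poly C = (\<Prod>e\<leftarrow>es. [:- e, 1:])"
      by (metis mult_cancel_left pCons_eq_0_iff zero_neq_one)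
    have hermC: "mat_adjoint C = C"
    proof (rule eq_matI)
      fix i j assume "i < dim_row C" "j < dim_col C"
      then have ij: "i < m" "j < m" using C by auto
      have "mat_adjoint B $$ (Suc i, Suc j) = B $$ (Suc i, Suc j)" using hermB by simp
      then show "mat_adjoint C $$ (i, j) = C $$ (i, j)"
        using ij m B by (simp add: C_def)
    qed (use C in auto)
    from Cons.IH[OF C hermC cpC] obtain P where P: "unitary_mat m P"
      and CP: "C = P * mat_diag m (\<lambda>i. es ! i) * mat_adjoint P" by blast
    note Pc = unitary_matD[OF P]
    let ?P = "four_block_mat (1\<^sub>m 1) (0\<^sub>m 1 m) (0\<^sub>m m 1) P"
    let ?D = "mat_diag n (\<lambda>i. (e # es) ! i)"
    have D: "?D = four_block_mat E (0\<^sub>m 1 m) (0\<^sub>m m 1) (mat_diag m (\<lambda>i. es ! i))"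
      by (rule eq_matI) (auto simp: mat_diag_def E_def m nth_Cons')
    have uP: "unitary_mat n ?P" using unitary_mat_four_block[OF P] m by simp
    have "?P * ?D * mat_adjoint ?P = B"
      unfolding D Bblock CP using Pc E
      by (simp add: mat_adjoint_four_block mult_four_block_diag)
    then have "A = W * (?P * ?D * mat_adjoint ?P) * mat_adjoint W"
      using unitary_conjugate_cancel[OF W A] by (simp add: B_def)
    also have "\<dots> = (W * ?P) * ?D * mat_adjoint (W * ?P)"
      using Wc unitary_matD[OF uP] mat_diag_dim[of n "\<lambda>i. (e # es) ! i"]
      by (simp add: mat_adjoint_mult[of _ n n _ n] assoc_mult_mat[of _ n n _ n _ n]
      mult_carrier_mat[of _ n n _ n])
    finally show ?case using unitary_mat_mult[OF W uP] by blast
  qed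
  then show thesis using that by blast
qed

section \<open>The ordered list of eigenvalues\<close>

text \<open>The head of \<open>es\<close> is a root of the other product, hence occurs in
  \<open>fs\<close>; cancel its linear factor and recurse.\<close>

lemma mset_eq_if_prod_linear_eq:
  fixes es fs :: "'a :: idom list"
  assumes "(\<Prod>e\<leftarrow>es. [:- e, 1:]) = (\<Prod>e\<leftarrow>fs. [:- e, 1:])"
  shows "mset es = mset fs"
  using assms
proof (induction es arbitrary: fs)
  case Nil
  show ?case
  proof (cases fs)
    case (Cons f fs')
    have "poly (\<Prod>e\<leftarrow>fs. [:- e, 1:]) f = 0" by (simp add: Cons)
    then show ?thesis using Nil by simp
  qed simp
next
  case (Cons e es)
  have "poly (\<Prod>f\<leftarrow>fs. [:- f, 1:]) e = 0" by (simp flip: Cons.prems)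
  then have "e \<in> set fs" by (auto simp: poly_prod_list prod_list_zero_iff)
  then obtain xs ys where fs: "fs = xs @ e # ys" by (meson split_list)
  then have "[:- e, 1:] * (\<Prod>e\<leftarrow>es. [:- e, 1:]) = [:- e, 1:] * (\<Prod>e\<leftarrow>xs @ ys. [:- e, 1:])"
    using Cons.prems by (simp add: mult_ac del: mult_pCons_left mult_pCons_right)
  then have "(\<Prod>e\<leftarrow>es. [:- e, 1:]) = (\<Prod>e\<leftarrow>xs @ ys. [:- e, 1:])"
    by (metis mult_cancel_left pCons_eq_0_iff zero_neq_one)
  from Cons.IH[OF this] show ?case by (simp add: fs)
qed

text \<open>Resolves the definite description: the polynomial determines the multiset of roots, and
  a multiset has only one sorted list.\<close>

lemma ordered_eigenvalues_eqI:
  assumes "sorted es" "char_poly A = (\<Prod>e\<leftarrow>es. [:- complex_of_real e, 1:])"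
  shows "ordered_eigenvalues A = es"
  unfolding ordered_eigenvalues_def
proof (rule the_equality)
  fix fs assume fs: "sorted fs \<and> char_poly A = (\<Prod>e\<leftarrow>fs. [:- complex_of_real e, 1:])"
  then have "(\<Prod>e\<leftarrow>map complex_of_real fs. [:- e, 1:]) = (\<Prod>e\<leftarrow>map complex_of_real es. [:- e, 1:])"
    using assms(2) by (simp add: o_def)
  from mset_eq_if_prod_linear_eq[OF this]
  have "image_mset complex_of_real (mset fs) = image_mset complex_of_real (mset es)" by simp
  then have "mset fs = mset es"
    by (metis multiset.inj_map_strong of_real_eq_iff)
  then show "fs = es" using fs assms(1) by (metis properties_for_sort)
qed (use assms in auto)

text \<open>Two diagonalisations are made. The first takes the complex roots in any order and shows
  them real, because the diagonal matrix is again Hermitian. The second takes them sorted, so that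
  the diagonal is \<open>ordered_eigenvalues A\<close>.\<close>

lemma hermitian_spectral_decomposition:
  assumes A: "A \<in> carrier_mat n n" and herm: "mat_adjoint A = A"
  obtains U where "unitary_mat n U" "length (ordered_eigenvalues A) = n"
    "sorted (ordered_eigenvalues A)"
    "A = U * mat_diag n (\<lambda>i. complex_of_real (ordered_eigenvalues A ! i)) * mat_adjoint U"
proof -
  obtain as where as: "char_poly A = (\<Prod>a\<leftarrow>as. [:- a, 1:])" "length as = n"
    using char_poly_factorized[OF A] by blast
  obtain U where U: "unitary_mat n U" and AU: "A = U * mat_diag n (\<lambda>i. as ! i) * mat_adjoint U"
    using hermitian_diagonalization[OF A herm as(1)] .
  note Uc = unitary_matD[OF U]
  let ?D = "mat_diag n (\<lambda>i. as ! i)"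
  have D: "?D \<in> carrier_mat n n" by simp
  have "mat_adjoint U * A * U = mat_adjoint U * (U * ?D * mat_adjoint U) * U"
    using AU by simp
  also have "\<dots> = ?D"
  proof -
    have "unitary_mat n (mat_adjoint U)" using Uc by (simp add: unitary_mat_def)
    from unitary_conjugate_cancel[OF this D] show ?thesis by simp
  qed
  finally have UAU: "?D = mat_adjoint U * A * U" ..
  have hermD: "mat_adjoint ?D = ?D"
    unfolding UAU using Uc(1,2) A herm
    by (simp add: mat_adjoint_mult[of _ n n _ n] assoc_mult_mat[of _ n n _ n _ n]
      mult_carrier_mat[of _ n n _ n])
  have real: "complex_of_real (Re (as ! i)) = as ! i" if "i < n" for i
  proof -
    have "mat_adjoint ?D $$ (i, i) = ?D $$ (i, i)" using hermD by simp
    then show ?thesis using that by (simp add: mat_diag_def complex_eq_iff)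
  qed
  define es where "es = sort (map Re as)"
  have "map complex_of_real (map Re as) = as"
    using real as(2) by (intro nth_equalityI) auto
  then have "mset (map complex_of_real es) = mset as"
    unfolding es_def by (metis mset_map mset_sort)
  then have "mset (map (\<lambda>e. [:- e, 1:]) (map complex_of_real es)) = mset (map (\<lambda>e. [:- e, 1:]) as)"
    by (metis mset_map)
  then have cp: "char_poly A = (\<Prod>e\<leftarrow>map complex_of_real es. [:- e, 1:])"
    unfolding as(1) by (metis prod_mset_prod_list)
  have es: "ordered_eigenvalues A = es"
    using cp by (intro ordered_eigenvalues_eqI) (simp_all add: es_def o_def)
  have len: "length es = n" by (simp add: es_def as(2))
  obtain V where V: "unitary_mat n V"
    and AV: "A = V * mat_diag n (\<lambda>i. map complex_of_real es ! i) * mat_adjoint V"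
    using hermitian_diagonalization[OF A herm cp] .
  have "mat_diag n (\<lambda>i. map complex_of_real es ! i) = mat_diag n (\<lambda>i. complex_of_real (es ! i))"
    by (rule eq_matI) (auto simp: mat_diag_def len)
  moreover have "sorted es" by (simp add: es_def)
  ultimately show thesis using that[of V] V AV unfolding es by (simp only: len)
qed

section \<open>Quadratic forms in eigenvector coordinates\<close>

lemma cscalar_prod_mult_mat_vec:
  fixes U :: "complex mat"
  assumes "U \<in> carrier_mat n m" "u \<in> carrier_vec m" "w \<in> carrier_vec n"
  shows "(U *\<^sub>v u) \<bullet>c w = u \<bullet>c (mat_adjoint U *\<^sub>v w)"
proof -
  have "(U *\<^sub>v u) \<bullet>c w = (\<Sum>i<n. \<Sum>j<m. U $$ (i, j) * u $ j * cnj (w $ i))"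
    using assms by (simp add: scalar_prod_def atLeast0LessThan sum_distrib_right)
  also have "\<dots> = (\<Sum>j<m. \<Sum>i<n. U $$ (i, j) * u $ j * cnj (w $ i))" by (rule sum.swap)
  also have "\<dots> = u \<bullet>c (mat_adjoint U *\<^sub>v w)"
    using assms by (simp add: scalar_prod_def atLeast0LessThan sum_distrib_left mult_ac)
  finally show ?thesis .
qed

text \<open>\<open>mat_adjoint U *\<^sub>v w\<close> lists the coordinates of \<open>w\<close> in
  the orthonormal eigenbasis given by the columns of \<open>U\<close>. There the form is diagonal
  and the norm is unchanged.\<close>

lemma quadratic_form_diagonalized:
  assumes U: "unitary_mat n U" and w: "w \<in> carrier_vec n"
    and A: "A = U * mat_diag n (\<lambda>i. complex_of_real (d i)) * mat_adjoint U"
  shows "(A *\<^sub>v w) \<bullet>c w = complex_of_real (\<Sum>i<n. d i * (cmod ((mat_adjoint U *\<^sub>v w) $ i))\<^sup>2)"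
    and "w \<bullet>c w = complex_of_real (\<Sum>i<n. (cmod ((mat_adjoint U *\<^sub>v w) $ i))\<^sup>2)"
proof -
  note Uc = unitary_matD[OF U]
  define b where "b = mat_adjoint U *\<^sub>v w"
  have b: "b \<in> carrier_vec n" unfolding b_def by (rule mult_mat_vec_carrier[OF Uc(2) w])
  let ?D = "mat_diag n (\<lambda>i. complex_of_real (d i))"
  have D: "?D \<in> carrier_mat n n" by simp
  have Db: "?D *\<^sub>v b \<in> carrier_vec n" by (rule mult_mat_vec_carrier[OF D b])
  have "(?D *\<^sub>v b) $ i = d i * b $ i" if "i < n" for i
  proof -
    have "(?D *\<^sub>v b) $ i = (\<Sum>j<n. (if i = j then complex_of_real (d j) else 0) * b $ j)"
      using that b by (simp add: scalar_prod_def atLeast0LessThan mat_diag_def)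
    also have "\<dots> = (\<Sum>j<n. if i = j then d i * b $ i else 0)"
      by (intro sum.cong) auto
    finally show ?thesis using that by simp
  qed
  then have "(?D *\<^sub>v b) \<bullet>c b = (\<Sum>i<n. d i * b $ i * cnj (b $ i))"
    using b D by (simp add: scalar_prod_def atLeast0LessThan del: index_mult_mat_vec)
  also have "\<dots> = complex_of_real (\<Sum>i<n. d i * (cmod (b $ i))\<^sup>2)"
    by (simp add: complex_norm_square mult.assoc del: of_real_power)
  also have "A *\<^sub>v w = U *\<^sub>v (?D *\<^sub>v b)"
    unfolding A b_def using Uc(1,2) w D
    by (simp add: assoc_mult_mat_vec[of _ n n _ n] mult_carrier_mat[of _ n n _ n]
      mult_mat_vec_carrier[of _ n n])
  then have "(?D *\<^sub>v b) \<bullet>c b = (A *\<^sub>v w) \<bullet>c w"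
    using cscalar_prod_mult_mat_vec[OF Uc(1) Db w] by (simp add: b_def)
  finally show "(A *\<^sub>v w) \<bullet>c w = complex_of_real (\<Sum>i<n. d i * (cmod (b $ i))\<^sup>2)"
    by simp
  have "U *\<^sub>v b = w"
    using Uc w by (simp add: b_def flip: assoc_mult_mat_vec[of _ n n _ n])
  then have "w \<bullet>c w = b \<bullet>c b"
    using cscalar_prod_mult_mat_vec[OF Uc(1) b w] by (simp add: b_def)
  also have "\<dots> = complex_of_real (\<Sum>i<n. (cmod (b $ i))\<^sup>2)"
    using b by (simp add: scalar_prod_def atLeast0LessThan complex_norm_square del: of_real_power)
  finally show "w \<bullet>c w = complex_of_real (\<Sum>i<n. (cmod (b $ i))\<^sup>2)" .
qed

text \<open>At column \<open>k\<close> of \<open>U\<close>, a unit eigenvector, the form takes the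
  value of the \<open>k\<close>-th eigenvalue.\<close>

lemma ordered_eigenvalues_nonneg:
  assumes A: "A \<in> carrier_mat n n" "mat_adjoint A = A"
    and psd: "\<And>w. w \<in> carrier_vec n \<Longrightarrow> 0 \<le> (A *\<^sub>v w) \<bullet>c w"
    and k: "k < n"
  shows "0 \<le> ordered_eigenvalues A ! k"
proof -
  obtain U where U: "unitary_mat n U"
    and AU: "A = U * mat_diag n (\<lambda>i. complex_of_real (ordered_eigenvalues A ! i)) * mat_adjoint U"
    using hermitian_spectral_decomposition[OF A] by metis
  note Uc = unitary_matD[OF U]
  define w where "w = U *\<^sub>v unit_vec n k"
  have w: "w \<in> carrier_vec n" using Uc by (simp add: w_def)
  have "mat_adjoint U *\<^sub>v w = unit_vec n k"
    using Uc by (simp add: w_def flip: assoc_mult_mat_vec[of _ n n _ n])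
  then have "(A *\<^sub>v w) \<bullet>c w
      = complex_of_real (\<Sum>i<n. ordered_eigenvalues A ! i * (cmod (unit_vec n k $ i))\<^sup>2)"
    using quadratic_form_diagonalized(1)[OF U w AU] by simp
  also have "(\<Sum>i<n. ordered_eigenvalues A ! i * (cmod (unit_vec n k $ i))\<^sup>2)
      = (\<Sum>i<n. if i = k then ordered_eigenvalues A ! k else 0)"
    by (intro sum.cong) (auto simp: unit_vec_def)
  also have "\<dots> = ordered_eigenvalues A ! k" using k by simp
  finally show ?thesis using psd[OF w] by (simp add: less_eq_complex_def)
qed

section \<open>Eigenvalues of a leading principal submatrix\<close>

text \<open>Every product in the Leibniz formula contains an entry of row \<open>i\<close>.\<close>

lemma det_zero_row:
  fixes M :: "'a :: idom mat"
  assumes M: "M \<in> carrier_mat n n" and i: "i < n" and zero: "\<And>j. j < n \<Longrightarrow> M $$ (i, j) = 0"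
  shows "det M = 0"
proof -
  have *: "(\<Prod>l = 0..<n. M $$ (l, p l)) = 0" if "p permutes {0..<n}" for p
    using i zero[of "p i"] permutes_in_image[OF that, of i] by (intro prod_zero) auto
  show ?thesis
    unfolding det_def'[OF M] by (intro sum.neutral ballI) (simp add: * del: prod_zero_iff)
qed

text \<open>One half of Cauchy's interlacing theorem. The span of the first \<open>k + 1\<close> eigenvectors of the
  submatrix meets the span of all but the first \<open>k\<close> eigenvectors of \<open>A\<close>, because \<open>k\<close> linear
  conditions on \<open>k + 1\<close> coefficients (a square system padded with a zero row) have a nontrivial
  solution.\<close>

lemma leading_submatrix_eigenvalue_ge:
  assumes A: "A \<in> carrier_mat (Suc n) (Suc n)" "mat_adjoint A = A" and k: "k < n"
  defines "B \<equiv> mat n n (\<lambda>(i, j). A $$ (i, j))"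
  shows "ordered_eigenvalues A ! k \<le> ordered_eigenvalues B ! k"
proof -
  let ?fs = "ordered_eigenvalues A" and ?es = "ordered_eigenvalues B"
  have B: "B \<in> carrier_mat n n" by (simp add: B_def)
  have hermB: "mat_adjoint B = B"
  proof (rule eq_matI)
    fix i j assume "i < dim_row B" "j < dim_col B"
    then have ij: "i < n" "j < n" by (simp_all add: B_def)
    have "mat_adjoint A $$ (i, j) = A $$ (i, j)" using A(2) by simp
    then show "mat_adjoint B $$ (i, j) = B $$ (i, j)" using A(1) ij by (simp add: B_def)
  qed (simp_all add: B_def)
  obtain V where V: "unitary_mat (Suc n) V" and fs: "length ?fs = Suc n" "sorted ?fs"
    and AV: "A = V * mat_diag (Suc n) (\<lambda>i. complex_of_real (?fs ! i)) * mat_adjoint V"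
    using hermitian_spectral_decomposition[OF A] by metis
  obtain U where U: "unitary_mat n U" and es: "length ?es = n" "sorted ?es"
    and BU: "B = U * mat_diag n (\<lambda>i. complex_of_real (?es ! i)) * mat_adjoint U"
    using hermitian_spectral_decomposition[OF B hermB] by metis
  note Vc = unitary_matD[OF V] and Uc = unitary_matD[OF U]
  \<comment> \<open>For \<open>i < k\<close>, row \<open>i\<close> computes coordinate
    \<open>i\<close>, in the eigenbasis of \<open>A\<close>, of the combination of the first
    \<open>k + 1\<close> eigenvectors of \<open>B\<close> extended by a last entry 0. Row
    \<open>k\<close> is the padding.\<close>
  define M where "M = mat (Suc k) (Suc k)
    (\<lambda>(i, l). if i < k then \<Sum>j<n. mat_adjoint V $$ (i, j) * U $$ (j, l) else 0)"
  have M: "M \<in> carrier_mat (Suc k) (Suc k)" by (simp add: M_def)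
  have "det M = 0" by (rule det_zero_row[OF M, of k]) (auto simp: M_def)
  then obtain a0 where a0: "a0 \<in> carrier_vec (Suc k)" "a0 \<noteq> 0\<^sub>v (Suc k)" "M *\<^sub>v a0 = 0\<^sub>v (Suc k)"
    using det_0_iff_vec_prod_zero[OF M] by auto
  define a where "a = vec n (\<lambda>i. if i \<le> k then a0 $ i else 0)"
  define w where "w = U *\<^sub>v a"
  define w' where "w' = vec (Suc n) (\<lambda>i. if i < n then w $ i else 0)"
  define b where "b = mat_adjoint V *\<^sub>v w'"
  have a: "a \<in> carrier_vec n" by (simp add: a_def)
  have w: "w \<in> carrier_vec n" using Uc a by (simp add: w_def)
  have w': "w' \<in> carrier_vec (Suc n)" by (simp add: w'_def)
  have Uw: "mat_adjoint U *\<^sub>v w = a"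
    using Uc a by (simp add: w_def flip: assoc_mult_mat_vec[of _ n n _ n])
  have b0: "b $ i = 0" if i: "i < k" for i
  proof -
    have "b $ i = (\<Sum>j<n. mat_adjoint V $$ (i, j) * w $ j)"
      using i k Vc(1) w' unfolding b_def
      by (simp add: scalar_prod_def atLeast0LessThan w'_def)
    also have "\<dots> = (\<Sum>j<n. \<Sum>l<n. mat_adjoint V $$ (i, j) * (U $$ (j, l) * a $ l))"
      using Uc(1) a
      by (intro sum.cong) (auto simp: w_def scalar_prod_def atLeast0LessThan sum_distrib_left)
    also have "\<dots> = (\<Sum>l<n. \<Sum>j<n. mat_adjoint V $$ (i, j) * (U $$ (j, l) * a $ l))"
      by (rule sum.swap)
    also have "\<dots> = (\<Sum>l<n. (\<Sum>j<n. mat_adjoint V $$ (i, j) * U $$ (j, l)) * a $ l)"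
      by (simp add: sum_distrib_right mult.assoc)
    also have "\<dots> = (\<Sum>l<Suc k. (\<Sum>j<n. mat_adjoint V $$ (i, j) * U $$ (j, l)) * a0 $ l)"
      using k by (intro sum.mono_neutral_cong_right) (auto simp: a_def)
    also have "\<dots> = (M *\<^sub>v a0) $ i"
      using i a0(1) by (simp add: M_def scalar_prod_def atLeast0LessThan)
    finally show ?thesis using a0(3) i by simp
  qed
  have norm_w: "w' \<bullet>c w' = w \<bullet>c w"
    using w by (simp add: scalar_prod_def w'_def atLeast0LessThan)
  have form_w: "(A *\<^sub>v w') \<bullet>c w' = (B *\<^sub>v w) \<bullet>c w"
    using w A(1) by (simp add: scalar_prod_def w'_def B_def atLeast0LessThan)
  note qA = quadratic_form_diagonalized[OF V w' AV, folded b_def]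
  note qB = quadratic_form_diagonalized[OF U w BU, unfolded Uw]
  define N where "N = (\<Sum>i<n. (cmod (a $ i))\<^sup>2)"
  have N: "N = (\<Sum>i<Suc n. (cmod (b $ i))\<^sup>2)"
    using qA(2) qB(2) norm_w unfolding N_def by (metis of_real_eq_iff)
  \<comment> \<open>Both estimates compare with the common value of the two forms: \<open>b\<close>
    vanishes below \<open>k\<close>, where \<open>?fs ! i\<close> could be smaller than
    \<open>?fs ! k\<close>, and \<open>a\<close> vanishes above \<open>k\<close>, where
    \<open>?es ! i\<close> could exceed \<open>?es ! k\<close>.\<close>
  have "?fs ! k * N = (\<Sum>i<Suc n. ?fs ! k * (cmod (b $ i))\<^sup>2)" by (simp only: N sum_distrib_left)
  also have "\<dots> \<le> (\<Sum>i<Suc n. ?fs ! i * (cmod (b $ i))\<^sup>2)"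
  proof (rule sum_mono)
    fix i assume i: "i \<in> {..<Suc n}"
    show "?fs ! k * (cmod (b $ i))\<^sup>2 \<le> ?fs ! i * (cmod (b $ i))\<^sup>2"
    proof (cases "i < k")
      case False
      then show ?thesis using fs i by (intro mult_right_mono sorted_nth_mono) auto
    qed (simp add: b0)
  qed
  also have "\<dots> = (\<Sum>i<n. ?es ! i * (cmod (a $ i))\<^sup>2)"
    using qA(1) qB(1) form_w by (metis of_real_eq_iff)
  also have "\<dots> \<le> (\<Sum>i<n. ?es ! k * (cmod (a $ i))\<^sup>2)"
  proof (rule sum_mono)
    fix i assume i: "i \<in> {..<n}"
    show "?es ! i * (cmod (a $ i))\<^sup>2 \<le> ?es ! k * (cmod (a $ i))\<^sup>2"
    proof (cases "i \<le> k")
      case True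
      then show ?thesis using es k by (intro mult_right_mono sorted_nth_mono) auto
    qed (use i in \<open>simp add: a_def\<close>)
  qed
  also have "\<dots> = ?es ! k * N" by (simp add: N_def sum_distrib_left)
  finally have le: "?fs ! k * N \<le> ?es ! k * N" .
  \<comment> \<open>The kernel vector is nonzero, so \<open>N\<close> is positive and can be
    cancelled.\<close>
  obtain i where i: "i \<le> k" "a0 $ i \<noteq> 0"
    using a0(1,2) by (metis carrier_vecD eq_vecI index_zero_vec less_Suc_eq_le)
  then have "0 < (cmod (a $ i))\<^sup>2" using k by (simp add: a_def)
  also have "\<dots> \<le> N" unfolding N_def using i k by (intro member_le_sum) auto
  finally show ?thesis using le by simp
qed

subsection \<open>Gcd matrices\<close>

text \<open>The form equals the sum over \<open>e\<close> of
  \<open>(F \<circledast> moebius_mu) e\<close> times the squared modulus of \<open>s e\<close>,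
  where \<open>s e\<close> adds up the \<open>w $ i\<close> with \<open>e\<close> dividing
  \<open>x (Suc i)\<close>.\<close>

lemma gcd_matrix_psd:
  assumes pos: "\<And>i. i \<in> {1..n} \<Longrightarrow> 0 < x i"
    and nonneg: "\<And>i e. i \<in> {1..n} \<Longrightarrow> e dvd x i \<Longrightarrow> 0 \<le> (F \<circledast> moebius_mu) e"
    and w: "w \<in> carrier_vec n"
  shows "0 \<le> (gcd_matrix x F n *\<^sub>v w) \<bullet>c w"
proof -
  define E where "E = (\<Union>i<n. {e. e dvd x (Suc i)})"
  define h where "h = F \<circledast> moebius_mu"
  define s where "s e = (\<Sum>i<n. if e dvd x (Suc i) then w $ i else 0)" for e
  have E: "finite E" unfolding E_def using pos by auto
  have F: "F (gcd (x (Suc i)) (x (Suc j)))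
      = (\<Sum>e\<in>E. if e dvd x (Suc i) \<and> e dvd x (Suc j) then h e else 0)" if "i < n" "j < n" for i j
    unfolding h_def using that E by (intro gcd_moebius_expansion pos) (auto simp: E_def)
  have "(gcd_matrix x F n *\<^sub>v w) \<bullet>c w
      = (\<Sum>i<n. \<Sum>j<n. F (gcd (x (Suc i)) (x (Suc j))) * w $ j * cnj (w $ i))"
    using w by (simp add: gcd_matrix_def scalar_prod_def atLeast0LessThan sum_distrib_right)
  also have "\<dots> = (\<Sum>i<n. \<Sum>j<n. \<Sum>e\<in>E. h e * ((if e dvd x (Suc j) then w $ j else 0)
      * cnj (if e dvd x (Suc i) then w $ i else 0)))"
    by (intro sum.cong) (auto simp: F sum_distrib_right intro!: sum.cong)
  also have "\<dots> = (\<Sum>i<n. \<Sum>e\<in>E. \<Sum>j<n. h e * ((if e dvd x (Suc j) then w $ j else 0)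
      * cnj (if e dvd x (Suc i) then w $ i else 0)))"
    by (intro sum.cong refl sum.swap)
  also have "\<dots> = (\<Sum>e\<in>E. \<Sum>i<n. \<Sum>j<n. h e * ((if e dvd x (Suc j) then w $ j else 0)
      * cnj (if e dvd x (Suc i) then w $ i else 0)))"
    by (rule sum.swap)
  also have "\<dots> = (\<Sum>e\<in>E. h e * (s e * cnj (s e)))"
    unfolding s_def cnj_sum
    by (intro sum.cong refl, simp only: sum_product, simp only: sum_distrib_left, rule sum.swap)
  also have "\<dots> \<ge> 0"
  proof (rule sum_nonneg, rule mult_nonneg_nonneg)
    fix e assume "e \<in> E"
    then obtain i where "i < n" "e dvd x (Suc i)" unfolding E_def by auto
    then show "0 \<le> h e" unfolding h_def by (intro nonneg[of "Suc i"]) auto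
    show "0 \<le> s e * cnj (s e)" by (simp add: less_eq_complex_def)
  qed
  finally show ?thesis .
qed

lemma gcd_matrix_hermitian:
  assumes "\<And>i j. i \<in> {1..n} \<Longrightarrow> j \<in> {1..n} \<Longrightarrow> F (gcd (x i) (x j)) \<in> \<real>"
  shows "mat_adjoint (gcd_matrix x F n) = gcd_matrix x F n"
  by (rule eq_matI)
     (use assms in \<open>auto simp: gcd_matrix_def gcd.commute intro!: Reals_cnj_iff[THEN iffD1]\<close>)

lemma gcd_matrix_eigenvalue_convergent:
  assumes pos: "\<And>i. 1 \<le> i \<Longrightarrow> 0 < x i"
    and nonneg: "\<And>i e. 1 \<le> i \<Longrightarrow> e dvd x i \<Longrightarrow> 0 \<le> (F \<circledast> moebius_mu) e"
    and q: "1 \<le> q"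
  defines "L \<equiv> \<lambda>m. nth_eigenvalue (gcd_matrix x F (q + m)) q"
  shows "convergent L" and "0 \<le> lim L"
proof -
  \<comment> \<open>In the order on complex numbers this also makes the entries real, hence the
    symmetric matrix Hermitian.\<close>
  have "0 \<le> F (gcd (x i) (x j))" if "1 \<le> i" "1 \<le> j" for i j
  proof -
    have "F (gcd (x i) (x j)) = (\<Sum>e | e dvd gcd (x i) (x j). (F \<circledast> moebius_mu) e)"
      using pos[OF that(1)] by (intro moebius_inversion) simp
    also have "\<dots> \<ge> 0" by (intro sum_nonneg nonneg[OF that(1)]) auto
    finally show ?thesis .
  qed
  then have herm: "mat_adjoint (gcd_matrix x F n) = gcd_matrix x F n" for n
    by (intro gcd_matrix_hermitian nonnegative_complex_is_real) auto
  have carrier: "gcd_matrix x F n \<in> carrier_mat n n" for n by (simp add: gcd_matrix_def)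
  have L_nonneg: "0 \<le> L m" for m
    unfolding L_def nth_eigenvalue_def
  proof (rule ordered_eigenvalues_nonneg[OF carrier herm])
    show "0 \<le> (gcd_matrix x F (q + m) *\<^sub>v w) \<bullet>c w" if "w \<in> carrier_vec (q + m)" for w
      using pos nonneg that by (intro gcd_matrix_psd) auto
  qed (use q in simp)
  have "L (Suc m) \<le> L m" for m
  proof -
    have "mat (q + m) (q + m) (\<lambda>(i, j). gcd_matrix x F (Suc (q + m)) $$ (i, j))
        = gcd_matrix x F (q + m)"
      by (rule eq_matI) (auto simp: gcd_matrix_def)
    \<comment> \<open>The list of eigenvalues is indexed from 0, so the \<open>q\<close>-th smallest
      sits at \<open>q - 1\<close>, which is below the size \<open>q + m\<close> of the smaller
      matrix.\<close>
    then show ?thesis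
      using leading_submatrix_eigenvalue_ge[OF carrier herm, of "q - 1" "q + m"] q
      by (simp add: L_def nth_eigenvalue_def)
  qed
  then have "decseq L" by (rule decseq_SucI)
  then obtain a where a: "L \<longlonglongrightarrow> a"
    using decseq_convergent[of L 0] L_nonneg by blast
  then show "convergent L" by (rule convergentI)
  have "0 \<le> a" using a L_nonneg by (intro LIMSEQ_le_const[of L]) auto
  then show "0 \<le> lim L" using limI[OF a] by simp
qed

theorem theorem1p3:
  fixes x :: "nat \<Rightarrow> nat"
    and f :: "nat \<Rightarrow> nat \<Rightarrow> complex"
    and l :: "nat \<Rightarrow> nat"
    and c d q :: nat
  assumes "strict_mono_on {1..} x"
    and "\<forall>i\<ge>1. 0 < x i"
    and "1 \<le> c"
    and "1 \<le> q"
    and "\<forall>i\<in>{1..c}. f i \<in> class_C x"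
    and "\<forall>i\<in>{1..c}. \<forall>j\<in>{1..c}. i \<noteq> j \<longrightarrow> (\<exists>m>0. f i m \<noteq> f j m)"
    and "\<forall>i\<in>{1..c}. 0 < l i"
    and "d < (\<Sum>i=1..c. l i)"
  defines "F \<equiv> dirichlet_prod (\<lambda>i. dirichlet_power (f i) (l i)) c \<circledast> dirichlet_power moebius_mu d"
  shows "convergent (\<lambda>m. nth_eigenvalue (gcd_matrix x F (q + m)) q)
       \<and> 0 \<le> lim (\<lambda>m. nth_eigenvalue (gcd_matrix x F (q + m)) q)"
proof -
  define D where "D = {e. \<exists>i\<ge>1. e dvd x i}"
  interpret divisor_closed D
    by standard (use assms(2) in \<open>auto simp: D_def intro: dvd_trans dvd_pos_nat\<close>)
  have "nonneg_to_order D 1 (f i)" if "i \<in> {1..c}" for i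
    using assms(5) that
    by (intro nonneg_to_order_1I)
       (auto simp: class_C_def D_def less_eq_complex_def complex_is_Real_iff)
  then have "nonneg_to_order D (\<Sum>i=1..c. l i) (dirichlet_prod (\<lambda>i. dirichlet_power (f i) (l i)) c)"
    by (intro nonneg_to_order_prod nonneg_to_order_power)
  \<comment> \<open>The extra factor raises the number of Moebius factors to \<open>Suc d\<close>,
    which the strict bound on \<open>d\<close> keeps within the order of the product.\<close>
  moreover have "F \<circledast> moebius_mu
      = dirichlet_prod (\<lambda>i. dirichlet_power (f i) (l i)) c \<circledast> dirichlet_power moebius_mu (Suc d)"
    by (simp add: F_def dirichlet_conv_assoc)
  ultimately have "0 \<le> (F \<circledast> moebius_mu) e" if "1 \<le> i" "e dvd x i" for i e
    using assms(8) that unfolding nonneg_to_order_def D_def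
    by (metis (mono_tags, lifting) Suc_leI mem_Collect_eq)
  then show ?thesis
    using gcd_matrix_eigenvalue_convergent[of x F q] assms(2,4) by auto
qed

end
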